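(* Let $R$ be a valuation subsemiring of a unitgenerated idempotent semiring $K$. Let $\Gamma=K^\times/R^\times$, totally ordered by $[x]\leq[y]\iff xy^{-1}\in R$, where $[u]$ is the class of $u\in K^\times$. Let $v:K\rightarrow \Gamma_{\max}$ be the (well-defined, surjective) semiring homomorphism given by $v\left(\sum_{i\in I} x_i\right)=\sum_{i\in I}[x_i]$ for any finite set $I$ and any units $x_i\in K^\times$. To a saturated subsemigroup $U\subseteq \Gamma_{\max}$, associate the saturated $R$-submodule $v^{-1}(U)$ of $K$. This yields a bijective order-preserving (for inclusion) correspondence between saturated subsemigroups of $\Gamma_{\max}$ and saturated $R$-submodules of $K$. The inverse correspondence sends $M\subseteq K$ to $v(M)$.
   Context: Semirings are commutative with $0\neq 1$. A semiring is idempotent if $x+x=x$ for all $x$; it then carries the canonical partial order $x\leq y\iff x+y=y$. For a totally ordered abelian group $\Gamma$ (written multiplicatively), $\Gamma_{\max}=\Gamma\cup\{0\}$ is the idempotent semifield with $x+y=\max(x,y)$ and multiplication from $\Gamma$, with $0$ least and absorbing. $K^\times$ denotes the group of units of $K$. An idempotent semiring $K$ is unitgenerated if every element is a finite sum of units (the empty sum being $0$). Subsemigroups are additive and contain $0$. A subsemigroup (or subsemiring, or submodule) $N$ is saturated if $x\leq y$ and $y\in N$ imply $x\in N$. A valuation subsemiring of $K$ is a saturated subsemiring $R\subseteq K$ such that for every $x\in K^\times$, either $x\in R$ or $x^{-1}\in R$. *)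

theory Defs
  imports "HOL-Algebra.Coset" "HOL-Algebra.Ring"
begin

locale comm_semiring = semiring S + comm_monoid S for S (structure) +
  assumes zero_not_one: "\<zero> \<noteq> \<one>"

locale idempotent_semiring = comm_semiring +
  assumes add_idem: "x \<in> carrier S \<Longrightarrow> x \<oplus> x = x"

definition canonical_le :: "('a, 'm) ring_scheme \<Rightarrow> 'a \<Rightarrow> 'a \<Rightarrow> bool"
  where "canonical_le S x y \<longleftrightarrow> x \<oplus>\<^bsub>S\<^esub> y = y"

text \<open>Index sets of type \<^typ>\<open>nat set\<close> suffice for all finite families.\<close>

locale unitgenerated_idempotent_semiring = idempotent_semiring +
  assumes unitgenerated: "z \<in> carrier S \<Longrightarrow>
    \<exists>(I::nat set) x. finite I \<and> x \<in> I \<rightarrow> Units S \<and> z = (\<Oplus>i\<in>I. x i)"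

definition saturated :: "('a, 'm) ring_scheme \<Rightarrow> 'a set \<Rightarrow> bool"
  where "saturated S N \<longleftrightarrow> (\<forall>x\<in>carrier S. \<forall>y\<in>N. canonical_le S x y \<longrightarrow> x \<in> N)"

definition subsemigroup :: "('a, 'm) ring_scheme \<Rightarrow> 'a set \<Rightarrow> bool"
  where "subsemigroup S N \<longleftrightarrow>
    N \<subseteq> carrier S \<and> \<zero>\<^bsub>S\<^esub> \<in> N \<and> (\<forall>x\<in>N. \<forall>y\<in>N. x \<oplus>\<^bsub>S\<^esub> y \<in> N)"

definition subsemiring :: "('a, 'm) ring_scheme \<Rightarrow> 'a set \<Rightarrow> bool"
  where "subsemiring S R \<longleftrightarrow>
    subsemigroup S R \<and> \<one>\<^bsub>S\<^esub> \<in> R \<and> (\<forall>x\<in>R. \<forall>y\<in>R. x \<otimes>\<^bsub>S\<^esub> y \<in> R)"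

definition subsemimodule :: "('a, 'm) ring_scheme \<Rightarrow> 'a set \<Rightarrow> 'a set \<Rightarrow> bool"
  where "subsemimodule S R M \<longleftrightarrow>
    subsemigroup S M \<and> (\<forall>r\<in>R. \<forall>x\<in>M. r \<otimes>\<^bsub>S\<^esub> x \<in> M)"

definition valuation_subsemiring :: "('a, 'm) ring_scheme \<Rightarrow> 'a set \<Rightarrow> bool"
  where "valuation_subsemiring K R \<longleftrightarrow>
    subsemiring K R \<and> saturated K R \<and> (\<forall>x\<in>Units K. x \<in> R \<or> inv\<^bsub>K\<^esub> x \<in> R)"

locale totally_ordered_abelian_group = comm_group G for G (structure) +
  fixes rel :: "('a \<times> 'a) set"
  assumes linear_order: "linear_order_on (carrier G) rel"
    and mult_mono: "\<lbrakk>(x, y) \<in> rel; z \<in> carrier G\<rbrakk> \<Longrightarrow> (z \<otimes> x, z \<otimes> y) \<in> rel"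

text \<open>
  The idempotent semifield \<open>\<Gamma>\<^sub>m\<^sub>a\<^sub>x = \<Gamma> \<union> {0}\<close>: the adjoined zero is \<^const>\<open>None\<close>.
\<close>

fun max_add :: "('g \<times> 'g) set \<Rightarrow> 'g option \<Rightarrow> 'g option \<Rightarrow> 'g option"
  where
    "max_add rel None b = b"
  | "max_add rel (Some x) None = Some x"
  | "max_add rel (Some x) (Some y) = Some (if (x, y) \<in> rel then y else x)"

fun max_mult :: "('g, 'm) monoid_scheme \<Rightarrow> 'g option \<Rightarrow> 'g option \<Rightarrow> 'g option"
  where
    "max_mult G (Some x) (Some y) = Some (x \<otimes>\<^bsub>G\<^esub> y)"
  | "max_mult G _ _ = None"

definition max_semifield :: "('g, 'm) monoid_scheme \<Rightarrow> ('g \<times> 'g) set \<Rightarrow> 'g option ring"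
  where "max_semifield G rel =
    \<lparr>carrier = insert None (Some ` carrier G), mult = max_mult G, one = Some \<one>\<^bsub>G\<^esub>,
     zero = None, add = max_add rel\<rparr>"

definition sub_units :: "('a, 'm) ring_scheme \<Rightarrow> 'a set \<Rightarrow> 'a set"
  where "sub_units K R = Units (K\<lparr>carrier := R\<rparr>)"

definition value_group :: "('a, 'm) ring_scheme \<Rightarrow> 'a set \<Rightarrow> 'a set monoid"
  where "value_group K R = units_of K Mod sub_units K R"

definition unit_class :: "('a, 'm) ring_scheme \<Rightarrow> 'a set \<Rightarrow> 'a \<Rightarrow> 'a set"
  where "unit_class K R x = sub_units K R #>\<^bsub>units_of K\<^esub> x"

definition value_le :: "('a, 'm) ring_scheme \<Rightarrow> 'a set \<Rightarrow> ('a set \<times> 'a set) set"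
  where "value_le K R =
    {(unit_class K R x, unit_class K R y) | x y.
       x \<in> Units K \<and> y \<in> Units K \<and> x \<otimes>\<^bsub>K\<^esub> inv\<^bsub>K\<^esub> y \<in> R}"

definition value_semifield :: "('a, 'm) ring_scheme \<Rightarrow> 'a set \<Rightarrow> 'a set option ring"
  where "value_semifield K R = max_semifield (value_group K R) (value_le K R)"

definition valuation :: "('a, 'm) ring_scheme \<Rightarrow> 'a set \<Rightarrow> 'a \<Rightarrow> 'a set option"
  where "valuation K R z =
    (THE w. \<exists>(I::nat set) x. finite I \<and> x \<in> I \<rightarrow> Units K \<and>
       z = (\<Oplus>\<^bsub>K\<^esub>i\<in>I. x i) \<and> w = (\<Oplus>\<^bsub>value_semifield K R\<^esub>i\<in>I. Some (unit_class K R (x i))))"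

text \<open>\<^const>\<open>ring_hom\<close> does not by itself ask for preservation of zero.\<close>

definition semiring_hom :: "('a, 'm) ring_scheme \<Rightarrow> ('b, 'n) ring_scheme \<Rightarrow> ('a \<Rightarrow> 'b) set"
  where "semiring_hom S T = {h \<in> ring_hom S T. h \<zero>\<^bsub>S\<^esub> = \<zero>\<^bsub>T\<^esub>}"

definition saturated_subsemigroups :: "('a, 'm) ring_scheme \<Rightarrow> 'a set set"
  where "saturated_subsemigroups S = {U. subsemigroup S U \<and> saturated S U}"

definition saturated_submodules :: "('a, 'm) ring_scheme \<Rightarrow> 'a set \<Rightarrow> 'a set set"
  where "saturated_submodules K R = {M. subsemimodule K R M \<and> saturated K M}"

definition valuation_preimage ::
    "('a, 'm) ring_scheme \<Rightarrow> 'a set \<Rightarrow> 'a set option set \<Rightarrow> 'a set"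
  where "valuation_preimage K R U = {z \<in> carrier K. valuation K R z \<in> U}"

end

theory Submission
  imports Defs
begin

text \<open>
  For a unit \<open>y\<close>, saturation and closure of \<open>R\<close> under sums show that \<open>v z \<le> [y]\<close> exactly when
  \<open>z \<in> R y\<close>. This characterizes \<open>v z\<close> without reference to a presentation of \<open>z\<close> as a sum of
  units. A saturated submodule \<open>M\<close> is then a lower set for \<open>v\<close>: if \<open>0 \<noteq> v z \<le> v m\<close> with
  \<open>m \<in> M\<close>, a unit \<open>y \<le> m\<close> of the same class as \<open>m\<close> lies in \<open>M\<close> by saturation, and
  \<open>z \<in> R y \<subseteq> M\<close>. So \<open>M = v\<^sup>-\<^sup>1(v(M))\<close>.
\<close>

section \<open>The semifield of a totally ordered abelian group\<close>

context totally_ordered_abelian_group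
begin

lemma rel_refl: "x \<in> carrier G \<Longrightarrow> (x, x) \<in> rel"
  using linear_order by (simp add: order_on_defs refl_on_def)

lemma rel_antisym: "(x, y) \<in> rel \<Longrightarrow> (y, x) \<in> rel \<Longrightarrow> x = y"
  using linear_order by (auto simp: order_on_defs dest: antisymD)

lemma rel_trans: "(x, y) \<in> rel \<Longrightarrow> (y, z) \<in> rel \<Longrightarrow> (x, z) \<in> rel"
  using linear_order by (auto simp: order_on_defs dest: transD)

lemma rel_total: "x \<in> carrier G \<Longrightarrow> y \<in> carrier G \<Longrightarrow> (x, y) \<in> rel \<or> (y, x) \<in> rel"
  using linear_order rel_refl by (cases "x = y") (auto simp: order_on_defs total_on_def)

lemma max_add_closed:
  "a \<in> insert None (Some ` carrier G) \<Longrightarrow> b \<in> insert None (Some ` carrier G)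
    \<Longrightarrow> max_add rel a b \<in> insert None (Some ` carrier G)"
  by auto

text \<open>\<open>max_add\<close> tests only one direction of the relation. Totality supplies the
  other direction when the test fails, and antisymmetry settles the case where both hold.\<close>

lemma max_add_comm:
  "a \<in> insert None (Some ` carrier G) \<Longrightarrow> b \<in> insert None (Some ` carrier G)
    \<Longrightarrow> max_add rel a b = max_add rel b a"
  using rel_antisym rel_total by fastforce

lemma max_add_None: "max_add rel a None = a"
  by (cases a) auto

text \<open>\<open>None\<close> is neutral, so only three group elements need an argument. There
  totality and transitivity force both bracketings to select the same one.\<close>

lemma max_add_assoc:
  assumes "a \<in> insert None (Some ` carrier G)" "b \<in> insert None (Some ` carrier G)"
    and "c \<in> insert None (Some ` carrier G)"
  shows "max_add rel (max_add rel a b) c = max_add rel a (max_add rel b c)"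
proof -
  consider "a = None" | "b = None" | "c = None"
    | x y z where "a = Some x" "b = Some y" "c = Some z"
      "x \<in> carrier G" "y \<in> carrier G" "z \<in> carrier G"
    using assms by blast
  then show ?thesis
  proof cases
    case (4 x y z)
    then show ?thesis
      using rel_total[of x y] rel_total[of y z] rel_trans[of x y z] rel_trans[of x z y]
        rel_trans[of y x z] rel_trans[of z y x] rel_antisym[of y z]
      by auto
  qed (simp_all add: max_add_None)
qed

text \<open>Translating back by the inverse upgrades monotonicity to an equivalence. Hence the test
  inside \<open>max_add\<close> has the same outcome before and after multiplication, which is what
  distributivity requires.\<close>

lemma mult_rel_iff:
  assumes "x \<in> carrier G" "y \<in> carrier G" "z \<in> carrier G"
  shows "(z \<otimes> x, z \<otimes> y) \<in> rel \<longleftrightarrow> (x, y) \<in> rel"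
proof
  assume "(z \<otimes> x, z \<otimes> y) \<in> rel"
  then have "(inv z \<otimes> (z \<otimes> x), inv z \<otimes> (z \<otimes> y)) \<in> rel"
    by (rule mult_mono) (use assms in simp)
  then show "(x, y) \<in> rel"
    using assms by (simp flip: m_assoc)
qed (use assms mult_mono in auto)

lemma max_distrib:
  "a \<in> insert None (Some ` carrier G) \<Longrightarrow> b \<in> insert None (Some ` carrier G)
    \<Longrightarrow> c \<in> insert None (Some ` carrier G)
    \<Longrightarrow> max_mult G c (max_add rel a b) = max_add rel (max_mult G c a) (max_mult G c b)"
  by (auto simp: mult_rel_iff)

lemma idempotent_semiring_max_semifield: "idempotent_semiring (max_semifield G rel)"
proof -
  let ?S = "max_semifield G rel"
  have add: "comm_monoid (add_monoid ?S)"
    by (rule comm_monoidI)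
      (auto simp: max_semifield_def max_add_None max_add_assoc max_add_comm
        intro: max_add_closed)
  have mult: "comm_monoid ?S"
  proof (rule comm_monoidI)
    fix a b c
    assume "a \<in> carrier ?S" "b \<in> carrier ?S" "c \<in> carrier ?S"
    then show "a \<otimes>\<^bsub>?S\<^esub> b \<otimes>\<^bsub>?S\<^esub> c = a \<otimes>\<^bsub>?S\<^esub> (b \<otimes>\<^bsub>?S\<^esub> c)"
      by (auto simp: max_semifield_def m_assoc)
  qed (auto simp: max_semifield_def m_comm)
  have null: "max_mult G a None = None" for a
    by (cases a) auto
  have distrib: "c \<otimes>\<^bsub>?S\<^esub> (a \<oplus>\<^bsub>?S\<^esub> b) = c \<otimes>\<^bsub>?S\<^esub> a \<oplus>\<^bsub>?S\<^esub> c \<otimes>\<^bsub>?S\<^esub> b"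
    if "a \<in> carrier ?S" "b \<in> carrier ?S" "c \<in> carrier ?S" for a b c
    using that max_distrib by (simp add: max_semifield_def)
  have "semiring ?S"
  proof (intro semiring.intro semiring_axioms.intro abelian_monoid.intro add)
    show "monoid ?S"
      using mult by (simp add: comm_monoid_def)
    show "(a \<oplus>\<^bsub>?S\<^esub> b) \<otimes>\<^bsub>?S\<^esub> c = a \<otimes>\<^bsub>?S\<^esub> c \<oplus>\<^bsub>?S\<^esub> b \<otimes>\<^bsub>?S\<^esub> c"
      if "a \<in> carrier ?S" "b \<in> carrier ?S" "c \<in> carrier ?S" for a b c
    proof -
      have "a \<oplus>\<^bsub>?S\<^esub> b \<in> carrier ?S"
        using that max_add_closed by (simp add: max_semifield_def)
      then show ?thesis
        using that distrib comm_monoid.m_comm[OF mult] by metis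
    qed
  qed (auto simp: distrib, auto simp: max_semifield_def null)
  moreover have "\<zero>\<^bsub>?S\<^esub> \<noteq> \<one>\<^bsub>?S\<^esub>"
    by (simp add: max_semifield_def)
  moreover have "a \<oplus>\<^bsub>?S\<^esub> a = a" if "a \<in> carrier ?S" for a
    using that by (auto simp: max_semifield_def)
  ultimately show ?thesis
    using mult
    by (simp add: idempotent_semiring_def idempotent_semiring_axioms_def
        comm_semiring_def comm_semiring_axioms_def)
qed

end

section \<open>The canonical order of an idempotent semiring\<close>

context idempotent_semiring
begin

abbreviation le :: "'a \<Rightarrow> 'a \<Rightarrow> bool" (infix "\<preceq>" 50)
  where "x \<preceq> y \<equiv> canonical_le S x y"

lemma le_refl: "x \<in> carrier S \<Longrightarrow> x \<preceq> x"
  by (simp add: canonical_le_def add_idem)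

lemma le_trans:
  assumes "x \<in> carrier S" "y \<in> carrier S" "z \<in> carrier S" "x \<preceq> y" "y \<preceq> z"
  shows "x \<preceq> z"
  using assms unfolding canonical_le_def by (metis a_assoc)

lemma le_add:
  assumes "x \<in> carrier S" "y \<in> carrier S"
  shows "x \<preceq> x \<oplus> y" "y \<preceq> x \<oplus> y"
  using assms unfolding canonical_le_def by (metis a_assoc a_comm add_idem)+

lemma le_mult:
  assumes "x \<in> carrier S" "y \<in> carrier S" "z \<in> carrier S" "x \<preceq> y"
  shows "x \<otimes> z \<preceq> y \<otimes> z"
  using assms unfolding canonical_le_def by (metis l_distr)

lemma le_mult2:
  assumes "x \<in> carrier S" "y \<in> carrier S" "z \<in> carrier S" "w \<in> carrier S"
    and "x \<preceq> y" "z \<preceq> w"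
  shows "x \<otimes> z \<preceq> y \<otimes> w"
proof (rule le_trans)
  show "x \<otimes> z \<preceq> y \<otimes> z" "y \<otimes> z \<preceq> y \<otimes> w"
    using assms le_mult[of x y z] le_mult[of z w y] by (simp_all add: m_comm)
qed (use assms in auto)

lemma zero_not_Unit: "\<zero> \<notin> Units S"
  using Units_r_inv[of \<zero>] Units_inv_closed[of \<zero>] l_null zero_not_one by metis

text \<open>Only zero lies below zero. This keeps the two alternatives in \<open>has_value\<close>
  apart.\<close>

lemma Unit_not_le_zero: "x \<in> Units S \<Longrightarrow> \<not> x \<preceq> \<zero>"
  using zero_not_Unit by (auto simp: canonical_le_def Units_closed)

lemma inv_mult_Units:
  assumes "x \<in> Units S" "y \<in> Units S"
  shows "inv (x \<otimes> y) = inv x \<otimes> inv y"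
proof -
  interpret U: comm_group "units_of S"
    by (rule units_comm_group)
  show ?thesis
    using assms U.inv_mult[of x y] units_of_inv
    by (simp add: units_of_carrier units_of_mult)
qed

end

section \<open>The valuation\<close>

locale valued_semiring = unitgenerated_idempotent_semiring K for K (structure) +
  fixes R
  assumes valuation_subsemiring: "valuation_subsemiring K R"
begin

notation le (infix "\<preceq>" 50)

text \<open>This is membership of \<open>z\<close> in the cyclic submodule \<open>R y\<close>. Only
  \<open>y\<close> is meant to be a unit, so that arbitrary elements can be compared with classes of
  units.\<close>

definition dominated :: "'a \<Rightarrow> 'a \<Rightarrow> bool"
  where "dominated z y \<longleftrightarrow> z \<otimes> inv y \<in> R"

abbreviation cls :: "'a \<Rightarrow> 'a set"
  where "cls \<equiv> unit_class K R"

abbreviation V :: "'a set option ring"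
  where "V \<equiv> value_semifield K R"

abbreviation v :: "'a \<Rightarrow> 'a set option"
  where "v \<equiv> valuation K R"

lemma R_closed: "x \<in> R \<Longrightarrow> x \<in> carrier K"
  and R_zero: "\<zero> \<in> R"
  and R_one: "\<one> \<in> R"
  and R_add: "x \<in> R \<Longrightarrow> y \<in> R \<Longrightarrow> x \<oplus> y \<in> R"
  and R_mult: "x \<in> R \<Longrightarrow> y \<in> R \<Longrightarrow> x \<otimes> y \<in> R"
  and R_saturated: "x \<in> carrier K \<Longrightarrow> y \<in> R \<Longrightarrow> x \<preceq> y \<Longrightarrow> x \<in> R"
  and R_total: "x \<in> Units K \<Longrightarrow> x \<in> R \<or> inv x \<in> R"
  using valuation_subsemiring
  by (auto simp: valuation_subsemiring_def subsemiring_def subsemigroup_def saturated_def)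

section \<open>Comparison with units over \<open>R\<close>\<close>

lemma dominated_refl: "x \<in> Units K \<Longrightarrow> dominated x x"
  by (simp add: dominated_def R_one)

text \<open>Multiplication by \<open>inv y\<close> preserves the canonical order, and saturation of
  \<open>R\<close> does the rest.\<close>

lemma dominated_mono:
  assumes "a \<in> carrier K" "b \<in> carrier K" "y \<in> Units K" "a \<preceq> b" "dominated b y"
  shows "dominated a y"
  using assms R_saturated le_mult[of a b "inv y"] unfolding dominated_def by blast

lemma dominated_add:
  assumes "a \<in> carrier K" "b \<in> carrier K" "y \<in> Units K" "dominated a y" "dominated b y"
  shows "dominated (a \<oplus> b) y"
  using assms unfolding dominated_def by (simp add: l_distr R_add)

lemma dominated_mult:
  assumes "a \<in> carrier K" "b \<in> carrier K" "x \<in> Units K" "y \<in> Units K" "dominated a x" "dominated b y"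
  shows "dominated (a \<otimes> b) (x \<otimes> y)"
proof -
  have "(a \<otimes> b) \<otimes> inv (x \<otimes> y) = (a \<otimes> inv x) \<otimes> (b \<otimes> inv y)"
    using assms by (simp add: inv_mult_Units m_ac)
  then show ?thesis
    using assms R_mult unfolding dominated_def by simp
qed

text \<open>The quotients of \<open>z\<close> by \<open>x\<close> and of \<open>x\<close> by
  \<open>y\<close> multiply to the quotient of \<open>z\<close> by \<open>y\<close>, and
  \<open>R\<close> is closed under products.\<close>

lemma dominated_trans:
  assumes "z \<in> carrier K" "x \<in> Units K" "y \<in> Units K" "dominated z x" "dominated x y"
  shows "dominated z y"
proof -
  have "(z \<otimes> inv x) \<otimes> (x \<otimes> inv y) = z \<otimes> (inv x \<otimes> x) \<otimes> inv y"
    using assms by (simp add: m_assoc Units_closed del: Units_l_inv)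
  also have "\<dots> = z \<otimes> inv y"
    using assms by simp
  finally show ?thesis
    using assms R_mult unfolding dominated_def by metis
qed

text \<open>The two quotients are inverse to each other, so this is the valuation property of
  \<open>R\<close> applied to one of them.\<close>

lemma dominated_total:
  assumes "x \<in> Units K" "y \<in> Units K"
  shows "dominated x y \<or> dominated y x"
proof -
  have "inv (x \<otimes> inv y) = y \<otimes> inv x"
    using assms by (simp add: inv_mult_Units m_comm Units_closed)
  then show ?thesis
    using R_total[of "x \<otimes> inv y"] assms unfolding dominated_def by auto
qed

section \<open>The units of \<open>R\<close> and the ordered value group\<close>

lemma sub_units_iff: "u \<in> sub_units K R \<longleftrightarrow> u \<in> Units K \<and> u \<in> R \<and> inv u \<in> R"
proof
  assume "u \<in> sub_units K R"
  then obtain w where u: "u \<in> R" "w \<in> R" "w \<otimes> u = \<one>" "u \<otimes> w = \<one>"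
    by (auto simp: sub_units_def Units_def)
  then have "u \<in> Units K"
    using R_closed by (auto simp: Units_def)
  \<comment> \<open>Inverses are unique, so the inverse found inside \<open>R\<close> agrees with
    the one in \<open>K\<close>, and \<open>inv\<close> can be read in \<open>K\<close>
    throughout.\<close>
  moreover have "inv u = w"
    using u \<open>u \<in> Units K\<close> R_closed inv_unique[of w u "inv u"] by auto
  ultimately show "u \<in> Units K \<and> u \<in> R \<and> inv u \<in> R"
    using u by simp
next
  assume "u \<in> Units K \<and> u \<in> R \<and> inv u \<in> R"
  then show "u \<in> sub_units K R"
    by (auto simp: sub_units_def intro!: bexI[of _ "inv u"] simp: Units_def[of "K\<lparr>carrier := R\<rparr>"])
qed

lemma subgroup_sub_units: "subgroup (sub_units K R) (units_of K)"
proof -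
  interpret U: comm_group "units_of K"
    by (rule units_comm_group)
  show ?thesis
  proof (rule U.subgroupI)
    show "sub_units K R \<noteq> {}"
      using sub_units_iff[of \<one>] R_one by auto
  qed (auto simp: units_of_carrier units_of_mult units_of_inv sub_units_iff R_mult
      inv_mult_Units)
qed

text \<open>Two cosets agree iff the quotient of their representatives is a unit of
  \<open>R\<close>, that is, iff this quotient and its inverse lie in \<open>R\<close>. The classes
  are thus those of the preorder \<open>dominated\<close> on units.\<close>

lemma cls_eq_iff:
  assumes "x \<in> Units K" "y \<in> Units K"
  shows "cls x = cls y \<longleftrightarrow> dominated x y \<and> dominated y x"
proof -
  interpret U: comm_group "units_of K"
    by (rule units_comm_group)
  interpret N: subgroup "sub_units K R" "units_of K"
    by (rule subgroup_sub_units)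
  have "cls x = cls y \<longleftrightarrow> x \<in> sub_units K R #>\<^bsub>units_of K\<^esub> y"
    using assms U.repr_independence[of x "sub_units K R" y] U.repr_independenceD[of "sub_units K R" x y]
      subgroup_sub_units
    unfolding unit_class_def by (auto simp: units_of_carrier)
  also have "\<dots> \<longleftrightarrow> x \<otimes> inv y \<in> sub_units K R"
    using assms N.rcos_module[OF U.is_group, of y x]
    by (simp add: units_of_carrier units_of_mult units_of_inv)
  also have "\<dots> \<longleftrightarrow> dominated x y \<and> dominated y x"
    using assms unfolding sub_units_iff dominated_def
    by (simp add: inv_mult_Units m_comm Units_closed)
  finally show ?thesis .
qed

text \<open>\<open>value_le\<close> only asks for some pair of representatives. Equal classes
  dominate each other, so transitivity carries the relation over to any other pair.\<close>

lemma value_le_iff: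
  assumes "x \<in> Units K" "y \<in> Units K"
  shows "(cls x, cls y) \<in> value_le K R \<longleftrightarrow> dominated x y"
proof
  assume "(cls x, cls y) \<in> value_le K R"
  then obtain x' y' where *: "x' \<in> Units K" "y' \<in> Units K" "cls x = cls x'" "cls y = cls y'"
    "dominated x' y'"
    by (auto simp: value_le_def dominated_def)
  then show "dominated x y"
    using assms cls_eq_iff dominated_trans Units_closed by meson
qed (use assms in \<open>auto simp: value_le_def dominated_def\<close>)

lemma carrier_value_group: "carrier (value_group K R) = cls ` Units K"
  by (simp add: value_group_def carrier_FactGroup units_of_carrier unit_class_def)

lemma mult_value_group:
  assumes "x \<in> Units K" "y \<in> Units K"
  shows "cls x \<otimes>\<^bsub>value_group K R\<^esub> cls y = cls (x \<otimes> y)"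
proof -
  interpret U: comm_group "units_of K"
    by (rule units_comm_group)
  interpret N: normal "sub_units K R" "units_of K"
    by (rule U.subgroup_imp_normal[OF subgroup_sub_units])
  show ?thesis
    using assms N.rcos_sum[of x y]
    by (simp add: value_group_def unit_class_def units_of_carrier units_of_mult)
qed

lemma one_value_group: "\<one>\<^bsub>value_group K R\<^esub> = cls \<one>"
proof -
  interpret U: comm_group "units_of K"
    by (rule units_comm_group)
  show ?thesis
    using U.coset_mult_one[of "sub_units K R"] subgroup.subset[OF subgroup_sub_units]
    by (simp add: value_group_def unit_class_def units_of_one)
qed

text \<open>Every order axiom is read off from \<open>dominated\<close> on representatives.
  Antisymmetry is built in, since passing to classes identifies units that dominate each
  other.\<close>

lemma ordered_value_group: "totally_ordered_abelian_group (value_group K R) (value_le K R)"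
proof -
  have "comm_group (value_group K R)"
    unfolding value_group_def
    by (intro comm_group.abelian_FactGroup units_comm_group subgroup_sub_units)
  moreover have "linear_order_on (carrier (value_group K R)) (value_le K R)"
  proof -
    have sub: "value_le K R \<subseteq> cls ` Units K \<times> cls ` Units K"
      by (auto simp: value_le_def)
    have "trans (value_le K R)"
    proof (rule transI)
      fix a b c
      assume *: "(a, b) \<in> value_le K R" "(b, c) \<in> value_le K R"
      with sub obtain x y z where "a = cls x" "b = cls y" "c = cls z"
        "x \<in> Units K" "y \<in> Units K" "z \<in> Units K"
        by blast
      with * show "(a, c) \<in> value_le K R"
        using dominated_trans[of x y z] by (simp add: value_le_iff Units_closed)
    qed
    moreover have "antisym (value_le K R)"
    proof (rule antisymI)
      fix a b
      assume *: "(a, b) \<in> value_le K R" "(b, a) \<in> value_le K R"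
      with sub obtain x y where "a = cls x" "b = cls y" "x \<in> Units K" "y \<in> Units K"
        by blast
      with * show "a = b"
        by (simp add: value_le_iff cls_eq_iff)
    qed
    ultimately show ?thesis
      using sub dominated_total
      by (auto simp: order_on_defs carrier_value_group refl_on_def total_on_def
          value_le_iff dominated_refl)
  qed
  moreover have "(c \<otimes>\<^bsub>value_group K R\<^esub> a, c \<otimes>\<^bsub>value_group K R\<^esub> b) \<in> value_le K R"
    if *: "(a, b) \<in> value_le K R" and c: "c \<in> carrier (value_group K R)" for a b c
  proof -
    obtain x y z where "a = cls x" "b = cls y" "c = cls z"
      "x \<in> Units K" "y \<in> Units K" "z \<in> Units K" "dominated x y"
      using * c by (auto simp: carrier_value_group value_le_def dominated_def)
    then show ?thesis
      using dominated_mult[of z x z y] by (simp add: mult_value_group value_le_iff dominated_refl Units_closed)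
  qed
  ultimately show ?thesis
    by (simp add: totally_ordered_abelian_group_def totally_ordered_abelian_group_axioms_def)
qed

section \<open>The semifield of values\<close>

sublocale \<Gamma>: totally_ordered_abelian_group "value_group K R" "value_le K R"
  by (rule ordered_value_group)

sublocale V: idempotent_semiring V
  unfolding value_semifield_def by (rule \<Gamma>.idempotent_semiring_max_semifield)

lemma carrier_V: "carrier V = insert None ((\<lambda>x. Some (cls x)) ` Units K)"
  by (auto simp: value_semifield_def max_semifield_def carrier_value_group)

lemma zero_V: "\<zero>\<^bsub>V\<^esub> = None"
  and one_V: "\<one>\<^bsub>V\<^esub> = Some (cls \<one>)"
  by (simp_all add: value_semifield_def max_semifield_def one_value_group)

lemma add_V:
  assumes "x \<in> Units K" "y \<in> Units K"
  shows "Some (cls x) \<oplus>\<^bsub>V\<^esub> Some (cls y) = Some (cls (if dominated x y then y else x))"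
  using assms by (simp add: value_semifield_def max_semifield_def value_le_iff)

lemma mult_V:
  assumes "x \<in> Units K" "y \<in> Units K"
  shows "Some (cls x) \<otimes>\<^bsub>V\<^esub> Some (cls y) = Some (cls (x \<otimes> y))"
  using assms by (simp add: value_semifield_def max_semifield_def mult_value_group)

lemma mult_V_None: "None \<otimes>\<^bsub>V\<^esub> w = None" "w \<otimes>\<^bsub>V\<^esub> None = None"
  by (cases w; simp add: value_semifield_def max_semifield_def)+

text \<open>If \<open>x\<close> is not dominated by \<open>y\<close>, the sum is the class of
  \<open>x\<close>. It cannot equal the class of \<open>y\<close>, as equal classes dominate each
  other.\<close>

lemma le_V_iff:
  assumes "x \<in> Units K" "y \<in> Units K"
  shows "V.le (Some (cls x)) (Some (cls y)) \<longleftrightarrow> dominated x y"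
  using assms by (auto simp: canonical_le_def add_V cls_eq_iff dominated_refl)

lemma not_Some_le_None: "\<not> V.le (Some c) None"
  by (simp add: canonical_le_def value_semifield_def max_semifield_def)

text \<open>
  Any presentation of \<open>z \<noteq> 0\<close> as a sum of units has a summand \<open>x\<close> of largest class; it satisfies
  \<open>x \<le> z\<close> and, as \<open>R\<close> is closed under sums, \<open>z \<in> R x\<close>. These two properties determine the
  class of \<open>x\<close>, independently of the presentation.
\<close>

definition has_value :: "'a \<Rightarrow> 'a set option \<Rightarrow> bool"
  where "has_value z w \<longleftrightarrow>
    (z = \<zero> \<and> w = None) \<or> (\<exists>x\<in>Units K. w = Some (cls x) \<and> x \<preceq> z \<and> dominated z x)"

lemma has_value_Unit: "x \<in> Units K \<Longrightarrow> has_value x (Some (cls x))"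
  unfolding has_value_def using le_refl dominated_refl by blast

text \<open>If units \<open>x\<close> and \<open>y\<close> both witness a value of \<open>z\<close>,
  then \<open>x\<close> is below \<open>z\<close> and \<open>z\<close> is dominated by
  \<open>y\<close>, so \<open>x\<close> is dominated by \<open>y\<close>. By symmetry the classes
  agree. For zero there is no witness, as no unit lies below it.\<close>

lemma has_value_unique:
  assumes "z \<in> carrier K" "has_value z w" "has_value z w'"
  shows "w = w'"
proof (cases "z = \<zero>")
  case True
  then show ?thesis
    using assms Unit_not_le_zero by (auto simp: has_value_def)
next
  case False
  then obtain x y where "x \<in> Units K" "w = Some (cls x)" "x \<preceq> z" "dominated z x"
    "y \<in> Units K" "w' = Some (cls y)" "y \<preceq> z" "dominated z y"
    using assms(2,3) by (auto simp: has_value_def)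
  then show ?thesis
    using assms(1) dominated_mono by (auto simp: cls_eq_iff)
qed

text \<open>Of the two witnessing units, the one of larger class witnesses the sum: it is below one
  summand, hence below the sum, and it dominates both summands.\<close>

lemma has_value_add:
  assumes ab: "a \<in> carrier K" "b \<in> carrier K" and "has_value a w" "has_value b w'"
  shows "has_value (a \<oplus> b) (w \<oplus>\<^bsub>V\<^esub> w')"
proof -
  consider "a = \<zero>" "w = None" | "b = \<zero>" "w' = None"
    | x y where "x \<in> Units K" "y \<in> Units K" "w = Some (cls x)" "w' = Some (cls y)"
      "x \<preceq> a" "dominated a x" "y \<preceq> b" "dominated b y"
    using assms(3,4) by (auto simp: has_value_def)
  then show ?thesis
  proof cases
    case 1
    then show ?thesis
      using assms by (simp add: value_semifield_def max_semifield_def)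
  next
    case 2
    then show ?thesis
      using assms by (simp add: value_semifield_def max_semifield_def \<Gamma>.max_add_None)
  next
    case (3 x y)
    have le: "x \<preceq> a \<oplus> b" "y \<preceq> a \<oplus> b"
      using 3 ab le_trans[OF _ _ _ _ le_add(1)] le_trans[OF _ _ _ _ le_add(2)] Units_closed a_closed
      by meson+
    show ?thesis
    proof (cases "dominated x y")
      case True
      then have "dominated (a \<oplus> b) y"
        using 3 ab dominated_trans[of a x y] by (intro dominated_add)
      then show ?thesis
        using 3 le True by (auto simp: has_value_def add_V)
    next
      case False
      then have "dominated (a \<oplus> b) x"
        using 3 ab dominated_total[of x y] dominated_trans[of b y x] by (intro dominated_add) auto
      then show ?thesis
        using 3 le False by (auto simp: has_value_def add_V)
    qed
  qed
qed

text \<open>The product of the witnessing units is a witness, because both required properties are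
  compatible with products.\<close>

lemma has_value_mult:
  assumes ab: "a \<in> carrier K" "b \<in> carrier K" and "has_value a w" "has_value b w'"
  shows "has_value (a \<otimes> b) (w \<otimes>\<^bsub>V\<^esub> w')"
proof -
  consider "a = \<zero>" "w = None" | "b = \<zero>" "w' = None"
    | x y where "x \<in> Units K" "y \<in> Units K" "w = Some (cls x)" "w' = Some (cls y)"
      "x \<preceq> a" "dominated a x" "y \<preceq> b" "dominated b y"
    using assms(3,4) by (auto simp: has_value_def)
  then show ?thesis
  proof cases
    case (3 x y)
    then have "x \<otimes> y \<preceq> a \<otimes> b" "dominated (a \<otimes> b) (x \<otimes> y)"
      using ab by (auto intro!: le_mult2 dominated_mult)
    then show ?thesis
      using 3 by (auto simp: has_value_def mult_V)
  qed (use ab in \<open>simp_all add: has_value_def mult_V_None\<close>)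
qed

lemma has_value_finsum:
  assumes "finite I" "x \<in> I \<rightarrow> Units K"
  shows "has_value (\<Oplus>i\<in>I. x i) (\<Oplus>\<^bsub>V\<^esub>i\<in>I. Some (cls (x i)))"
  using assms
proof (induction I)
  case empty
  then show ?case
    by (simp add: has_value_def zero_V)
next
  case (insert i I)
  then have "x \<in> I \<rightarrow> carrier K" "x i \<in> Units K"
    and "(\<lambda>i. Some (cls (x i))) \<in> I \<rightarrow> carrier V" "Some (cls (x i)) \<in> carrier V"
    by (auto simp: carrier_V)
  with insert show ?case
    by (auto simp: Units_closed intro!: has_value_add has_value_Unit finsum_closed)
qed

section \<open>The valuation as a surjective homomorphism\<close>

lemma valuation_finsum_nat:
  fixes I :: "nat set"
  assumes "finite I" "x \<in> I \<rightarrow> Units K"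
  shows "v (\<Oplus>i\<in>I. x i) = (\<Oplus>\<^bsub>V\<^esub>i\<in>I. Some (cls (x i)))"
  unfolding valuation_def
proof (rule the_equality)
  fix w
  assume "\<exists>(J::nat set) y. finite J \<and> y \<in> J \<rightarrow> Units K \<and> (\<Oplus>i\<in>I. x i) = (\<Oplus>i\<in>J. y i)
    \<and> w = (\<Oplus>\<^bsub>V\<^esub>i\<in>J. Some (cls (y i)))"
  \<comment> \<open>Whatever presentation produced \<open>w\<close>, it is a value of the same
    element, so uniqueness of values makes the description well defined.\<close>
  then have "has_value (\<Oplus>i\<in>I. x i) w"
    using has_value_finsum by metis
  moreover have "(\<Oplus>i\<in>I. x i) \<in> carrier K"
    using assms by (auto intro!: finsum_closed)
  ultimately show "w = (\<Oplus>\<^bsub>V\<^esub>i\<in>I. Some (cls (x i)))"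
    using assms has_value_finsum has_value_unique by blast
qed (use assms in blast)

lemma has_value_valuation: "z \<in> carrier K \<Longrightarrow> has_value z (v z)"
  using unitgenerated[of z] valuation_finsum_nat has_value_finsum by metis

lemma valuation_eqI: "z \<in> carrier K \<Longrightarrow> has_value z w \<Longrightarrow> v z = w"
  using has_value_unique has_value_valuation by blast

lemma valuation_Unit: "x \<in> Units K \<Longrightarrow> v x = Some (cls x)"
  by (simp add: valuation_eqI has_value_Unit Units_closed)

lemma valuation_zero: "v \<zero> = None"
  by (rule valuation_eqI) (simp_all add: has_value_def)

lemma valuation_add: "a \<in> carrier K \<Longrightarrow> b \<in> carrier K \<Longrightarrow> v (a \<oplus> b) = v a \<oplus>\<^bsub>V\<^esub> v b"
  by (intro valuation_eqI has_value_add has_value_valuation) auto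

lemma valuation_mult: "a \<in> carrier K \<Longrightarrow> b \<in> carrier K \<Longrightarrow> v (a \<otimes> b) = v a \<otimes>\<^bsub>V\<^esub> v b"
  by (intro valuation_eqI has_value_mult has_value_valuation) auto

text \<open>The working form of the valuation: a nonzero element may be replaced by a unit below it
  with the same class.\<close>

lemma valuation_cases:
  assumes "z \<in> carrier K"
  obtains "z = \<zero>" "v z = None"
  | x where "x \<in> Units K" "v z = Some (cls x)" "x \<preceq> z" "dominated z x"
  using has_value_valuation[OF assms] by (auto simp: has_value_def)

lemma valuation_closed: "z \<in> carrier K \<Longrightarrow> v z \<in> carrier V"
  by (erule valuation_cases) (auto simp: carrier_V)

lemma valuation_surj: "v ` carrier K = carrier V"
proof
  show "carrier V \<subseteq> v ` carrier K"
    using valuation_zero valuation_Unit by (force simp: carrier_V)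
qed (auto intro: valuation_closed)

lemma valuation_mono:
  "a \<in> carrier K \<Longrightarrow> b \<in> carrier K \<Longrightarrow> a \<preceq> b \<Longrightarrow> V.le (v a) (v b)"
  by (simp add: canonical_le_def flip: valuation_add)

lemma valuation_hom: "v \<in> semiring_hom K V"
  by (auto simp: semiring_hom_def ring_hom_def valuation_closed valuation_mult valuation_add
      valuation_Unit valuation_zero zero_V one_V)

text \<open>Elements of \<open>R\<close> have value at most one, so scalars from \<open>R\<close>
  never raise a value.\<close>

lemma valuation_R_mult_le:
  assumes "r \<in> R" "z \<in> carrier K"
  shows "V.le (v (r \<otimes> z)) (v z)"
proof -
  have r: "r \<in> carrier K"
    using assms R_closed by blast
  have "V.le (v r) \<one>\<^bsub>V\<^esub>"
  proof (cases rule: valuation_cases[OF r])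
    case 1
    then show ?thesis
      using V.l_zero[of "\<one>\<^bsub>V\<^esub>"] by (simp add: canonical_le_def zero_V)
  next
    case (2 x)
    \<comment> \<open>The unit \<open>x\<close> lies below \<open>r\<close>, so saturation puts
      \<open>x\<close> itself in \<open>R\<close>.\<close>
    then have "dominated x \<one>"
      using R_saturated[of x r] assms by (auto simp: dominated_def)
    then show ?thesis
      using 2 by (simp add: one_V le_V_iff)
  qed
  then have "V.le (v r \<otimes>\<^bsub>V\<^esub> v z) (\<one>\<^bsub>V\<^esub> \<otimes>\<^bsub>V\<^esub> v z)"
    using assms r by (intro V.le_mult valuation_closed) auto
  then show ?thesis
    using assms r by (simp add: valuation_mult valuation_closed)
qed

section \<open>Saturated submodules\<close>

text \<open>Closure under scalars comes from saturation of \<open>U\<close>, because multiplying by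
  an element of \<open>R\<close> can only lower the value. Saturation of the preimage comes from
  monotonicity of \<open>v\<close>.\<close>

lemma preimage_saturated_submodule:
  assumes U: "U \<in> saturated_subsemigroups V"
  shows "valuation_preimage K R U \<in> saturated_submodules K R"
proof -
  have zero: "\<zero>\<^bsub>V\<^esub> \<in> U" and add: "\<And>a b. a \<in> U \<Longrightarrow> b \<in> U \<Longrightarrow> a \<oplus>\<^bsub>V\<^esub> b \<in> U"
    and sat: "\<And>a b. a \<in> carrier V \<Longrightarrow> b \<in> U \<Longrightarrow> V.le a b \<Longrightarrow> a \<in> U"
    using U by (auto simp: saturated_subsemigroups_def subsemigroup_def saturated_def)
  have "r \<otimes> z \<in> valuation_preimage K R U" if "r \<in> R" "z \<in> valuation_preimage K R U" for r z
    using that sat valuation_closed valuation_R_mult_le[of r z] R_closed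
    by (auto simp: valuation_preimage_def)
  moreover have "a \<in> valuation_preimage K R U"
    if "a \<in> carrier K" "b \<in> valuation_preimage K R U" "a \<preceq> b" for a b
    using that sat valuation_closed valuation_mono[of a b]
    by (auto simp: valuation_preimage_def)
  ultimately show ?thesis
    using zero add
    by (auto simp: saturated_submodules_def subsemimodule_def subsemigroup_def saturated_def
        valuation_preimage_def valuation_add valuation_zero zero_V)
qed

lemma submodule_mem_of_valuation_le:
  assumes M: "M \<in> saturated_submodules K R" and m: "m \<in> M" and z: "z \<in> carrier K"
    and le: "V.le (v z) (v m)"
  shows "z \<in> M"
proof -
  have M_closed: "M \<subseteq> carrier K" and M_zero: "\<zero> \<in> M"
    and M_mult: "\<And>r a. r \<in> R \<Longrightarrow> a \<in> M \<Longrightarrow> r \<otimes> a \<in> M"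
    and M_sat: "\<And>a b. a \<in> carrier K \<Longrightarrow> b \<in> M \<Longrightarrow> a \<preceq> b \<Longrightarrow> a \<in> M"
    using M by (auto simp: saturated_submodules_def subsemimodule_def subsemigroup_def saturated_def)
  have m': "m \<in> carrier K"
    using m M_closed by blast
  show ?thesis
  proof (cases rule: valuation_cases[OF z])
    case (2 x)
    \<comment> \<open>The case \<open>m = 0\<close> is excluded: its value is \<open>None\<close>,
      and no \<open>Some\<close> lies below that.\<close>
    then obtain y where y: "y \<in> Units K" "v m = Some (cls y)" "y \<preceq> m"
      using le not_Some_le_None by (cases rule: valuation_cases[OF m']) auto
    then have "dominated x y"
      using le 2 by (simp add: le_V_iff)
    then have "dominated z y"
      using dominated_trans z 2 y by blast
    moreover have "y \<in> M"
      using M_sat m y by blast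
    \<comment> \<open>Being dominated by \<open>y\<close> says exactly that this coefficient belongs
      to \<open>R\<close>.\<close>
    ultimately have "(z \<otimes> inv y) \<otimes> y \<in> M"
      using M_mult by (simp add: dominated_def)
    then show ?thesis
      using z y by (simp add: m_assoc Units_closed)
  qed (use M_zero in simp)
qed

text \<open>For saturation, surjectivity lifts a smaller value to some \<open>z\<close> in
  \<open>K\<close>, and \<open>submodule_mem_of_valuation_le\<close> places \<open>z\<close> in
  \<open>M\<close>.\<close>

lemma image_saturated_subsemigroup:
  assumes M: "M \<in> saturated_submodules K R"
  shows "v ` M \<in> saturated_subsemigroups V"
proof -
  have M_closed: "M \<subseteq> carrier K" and M_zero: "\<zero> \<in> M"
    and M_add: "\<And>a b. a \<in> M \<Longrightarrow> b \<in> M \<Longrightarrow> a \<oplus> b \<in> M"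
    using M by (auto simp: saturated_submodules_def subsemimodule_def subsemigroup_def)
  have "\<zero>\<^bsub>V\<^esub> \<in> v ` M"
    using M_zero valuation_zero zero_V by force
  moreover have "v a \<oplus>\<^bsub>V\<^esub> v b \<in> v ` M" if "a \<in> M" "b \<in> M" for a b
    using that M_closed M_add valuation_add by (metis image_eqI subsetD)
  moreover have "w \<in> v ` M" if w: "w \<in> carrier V" "m \<in> M" "V.le w (v m)" for w m
  proof -
    obtain z where "z \<in> carrier K" "w = v z"
      using w(1) unfolding valuation_surj[symmetric] by (rule imageE)
    then show ?thesis
      using w submodule_mem_of_valuation_le[OF M, of m z] by simp
  qed
  ultimately show ?thesis
    using M_closed valuation_closed
    by (auto simp: saturated_subsemigroups_def subsemigroup_def saturated_def)
qed

section \<open>The mutually inverse correspondences\<close>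

lemma preimage_image:
  assumes M: "M \<in> saturated_submodules K R"
  shows "valuation_preimage K R (v ` M) = M"
proof
  show "valuation_preimage K R (v ` M) \<subseteq> M"
  proof
    fix z
    assume "z \<in> valuation_preimage K R (v ` M)"
    then obtain m where "z \<in> carrier K" "m \<in> M" "v z = v m"
      by (auto simp: valuation_preimage_def)
    \<comment> \<open>Equal values are in particular comparable, so \<open>M\<close> is a union of
      fibres of \<open>v\<close>.\<close>
    then show "z \<in> M"
      using submodule_mem_of_valuation_le[OF M, of m z] V.le_refl valuation_closed by metis
  qed
  show "M \<subseteq> valuation_preimage K R (v ` M)"
    using M by (auto simp: valuation_preimage_def saturated_submodules_def subsemimodule_def
        subsemigroup_def)
qed

text \<open>This is surjectivity of \<open>v\<close> onto the carrier.\<close>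

lemma image_preimage:
  assumes "U \<in> saturated_subsemigroups V"
  shows "v ` valuation_preimage K R U = U"
proof -
  have "U \<subseteq> v ` carrier K"
    using assms by (simp add: valuation_surj saturated_subsemigroups_def subsemigroup_def)
  then show ?thesis
    by (auto simp: valuation_preimage_def)
qed

lemma preimage_bij:
  "bij_betw (valuation_preimage K R) (saturated_subsemigroups V) (saturated_submodules K R)"
  by (rule bij_betw_byWitness[of _ "image v"])
    (use image_preimage preimage_image preimage_saturated_submodule
      image_saturated_subsemigroup in auto)

text \<open>Inclusion is also reflected, since taking images under \<open>v\<close> recovers
  \<open>U\<close> and \<open>U'\<close> from their preimages.\<close>

lemma preimage_subset_iff:
  assumes "U \<in> saturated_subsemigroups V" "U' \<in> saturated_subsemigroups V"
  shows "U \<subseteq> U' \<longleftrightarrow> valuation_preimage K R U \<subseteq> valuation_preimage K R U'"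
proof
  assume "valuation_preimage K R U \<subseteq> valuation_preimage K R U'"
  then show "U \<subseteq> U'"
    using image_mono image_preimage assms by metis
qed (auto simp: valuation_preimage_def)

text \<open>The definition of \<open>valuation\<close> quantifies over index sets of naturals only.
  Passing through \<open>has_value\<close>, which does not mention a presentation, frees the index
  type.\<close>

lemma valuation_finsum:
  assumes "finite I" "x \<in> I \<rightarrow> Units K"
  shows "v (\<Oplus>i\<in>I. x i) = (\<Oplus>\<^bsub>V\<^esub>i\<in>I. Some (cls (x i)))"
  using assms by (intro valuation_eqI has_value_finsum finsum_closed) auto

end

theorem theorem3p9:
  fixes K :: "('a, 'm) ring_scheme" and R :: "'a set"
  assumes "unitgenerated_idempotent_semiring K"
    and "valuation_subsemiring K R"
  shows
    "totally_ordered_abelian_group (value_group K R) (value_le K R)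
     \<and> (\<forall>x\<in>Units K. \<forall>y\<in>Units K.
          (unit_class K R x, unit_class K R y) \<in> value_le K R \<longleftrightarrow> x \<otimes>\<^bsub>K\<^esub> inv\<^bsub>K\<^esub> y \<in> R)
     \<and> idempotent_semiring (value_semifield K R)
     \<and> (\<forall>(I :: 'i set) x. finite I \<longrightarrow> x \<in> I \<rightarrow> Units K \<longrightarrow>
          valuation K R (\<Oplus>\<^bsub>K\<^esub>i\<in>I. x i)
            = (\<Oplus>\<^bsub>value_semifield K R\<^esub>i\<in>I. Some (unit_class K R (x i))))
     \<and> valuation K R \<in> semiring_hom K (value_semifield K R)
     \<and> valuation K R ` carrier K = carrier (value_semifield K R)
     \<and> bij_betw (valuation_preimage K R)
          (saturated_subsemigroups (value_semifield K R)) (saturated_submodules K R)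
     \<and> (\<forall>U\<in>saturated_subsemigroups (value_semifield K R).
          \<forall>U'\<in>saturated_subsemigroups (value_semifield K R).
            U \<subseteq> U' \<longleftrightarrow> valuation_preimage K R U \<subseteq> valuation_preimage K R U')
     \<and> (\<forall>M\<in>saturated_submodules K R.
          valuation K R ` M \<in> saturated_subsemigroups (value_semifield K R)
          \<and> valuation_preimage K R (valuation K R ` M) = M)
     \<and> (\<forall>U\<in>saturated_subsemigroups (value_semifield K R).
          valuation K R ` valuation_preimage K R U = U)"
proof -
  interpret valued_semiring K R
    using assms by (simp add: valued_semiring_def valued_semiring_axioms_def)
  show ?thesis
    using ordered_value_group value_le_iff V.idempotent_semiring_axioms valuation_finsum
      valuation_hom valuation_surj preimage_bij preimage_subset_iff image_saturated_subsemigroup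
      preimage_image image_preimage
    by (intro conjI ballI allI impI) (simp_all add: dominated_def)
qed

end
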